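(* Let $\mathbf{L}_r\in\mathbb{R}^{m\times m}$ and $\mathbf{L}_c\in\mathbb{R}^{n\times n}$ be the combinatorial Laplacians of the row and column graphs, let $\alpha,\beta>0$, and let $\Omega\subseteq\{1,\dots,m\}\times\{1,\dots,n\}$ be a sampling set with sampling operator $\mathbf{A}_\Omega$ such that $\mathbf{Q}=\tilde{\mathbf{A}}_{\Omega}+\alpha\mathbf{I}_n\otimes\mathbf{L}_{r}+\beta\mathbf{L}_{c}\otimes\mathbf{I}_m$ is invertible (hence positive definite). Let $\mathbf{X}\in\mathbb{R}^{m\times n}$ be the ground truth signal, corrupted by independent additive noise $\mathbf{N}\in\mathbb{R}^{m\times n}$, and let $\mathbf{Y}=\mathbf{A}_\Omega\circ(\mathbf{X}+\mathbf{N})$ be the observation. Let $\mathbf{X}^*$ be the reconstructed signal, i.e. the solution of $\mathbf{Q}\,\mathrm{vec}(\mathbf{X}^* )=\mathrm{vec}(\mathbf{Y})$. Then (for every realization of $\mathbf{N}$) $$\|\mathrm{vec}(\mathbf{X}^{*})-\mathrm{vec}(\mathbf{X})\|_2\leq\frac{\rho}{\lambda_{\min}(\mathbf{Q})}+\|\mathrm{vec}(\mathbf{N})\|_2,$$ where $\rho=\left\|\left(\alpha\mathbf{I}_n\otimes\mathbf{L}_{r}+\beta\mathbf{L}_{c}\otimes\mathbf{I}_m\right)\mathrm{vec}(\mathbf{X}+\mathbf{N})\right\|_2$.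
   Context: The row graph (vertices $\{1,\dots,m\}$) and the column graph (vertices $\{1,\dots,n\}$) are undirected weighted graphs without self-loops, with symmetric nonnegative weight matrices $\mathbf{W}_r,\mathbf{W}_c$. Their combinatorial Laplacians are $\mathbf{L}_r=\mathbf{D}_r-\mathbf{W}_r$ and $\mathbf{L}_c=\mathbf{D}_c-\mathbf{W}_c$, where $\mathbf{D}_r,\mathbf{D}_c$ are the diagonal degree matrices, $\mathbf{D}(i,i)=\sum_j\mathbf{W}(i,j)$. The sampling operator $\mathbf{A}_\Omega\in\{0,1\}^{m\times n}$ has $\mathbf{A}_\Omega(i,j)=1$ if $(i,j)\in\Omega$ and $0$ otherwise. $\mathrm{vec}(\cdot)$ stacks the columns of a matrix into a vector, $\mathrm{diag}(\cdot)$ forms a diagonal matrix from a vector, $\tilde{\mathbf{A}}_\Omega=\mathrm{diag}(\mathrm{vec}(\mathbf{A}_\Omega))$, $\circ$ is the entrywise product, $\otimes$ the Kronecker product, $\mathbf{I}_k$ the $k\times k$ identity, and $\lambda_{\min}$ the smallest eigenvalue of a symmetric matrix. The entries of $\mathbf{N}$ are zero-mean i.i.d. random variables with the same variance. *)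

theory Defs
  imports "HOL-Probability.Probability"
begin

text \<open>
  An \<open>m \<times> n\<close> matrix is an element of \<^typ>\<open>real^'n^'m\<close>, with entry \<open>X $ i $ j\<close> in row
  \<open>i\<close> and column \<open>j\<close>.
\<close>

definition weight_matrix :: "real^'k^'k \<Rightarrow> bool" where
  "weight_matrix W \<longleftrightarrow>
     transpose W = W \<and> (\<forall>i j. 0 \<le> W $ i $ j) \<and> (\<forall>i. W $ i $ i = 0)"

definition diag_matrix :: "real^'k \<Rightarrow> real^'k^'k" where
  "diag_matrix v = (\<chi> i j. if i = j then v $ i else 0)"

definition degree_matrix :: "real^'k^'k \<Rightarrow> real^'k^'k" where
  "degree_matrix W = diag_matrix (\<chi> i. \<Sum>j\<in>UNIV. W $ i $ j)"

definition laplacian :: "real^'k^'k \<Rightarrow> real^'k^'k" where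
  "laplacian W = degree_matrix W - W"

text \<open>
  Vectors of length \<open>m n\<close> are indexed by pairs (column, row). Ordered lexicographically these
  pairs enumerate the entries of a matrix column by column, so \<open>vectorize\<close> stacks the columns,
  and in \<open>kronecker A B\<close> the first components of the index pairs select the block (the entry
  of \<open>A\<close>) and the second components the position in the block (the entry of \<open>B\<close>).
\<close>

definition vectorize :: "real^'n^'m \<Rightarrow> real^('n \<times> 'm)" where
  "vectorize X = (\<chi> p. X $ snd p $ fst p)"

definition kronecker :: "real^'b^'a \<Rightarrow> real^'d^'c \<Rightarrow> real^('b \<times> 'd)^('a \<times> 'c)"
    (infixl "\<otimes>\<^sub>K" 75) where
  "A \<otimes>\<^sub>K B = (\<chi> p q. A $ fst p $ fst q * B $ snd p $ snd q)"

definition hadamard :: "real^'n^'m \<Rightarrow> real^'n^'m \<Rightarrow> real^'n^'m" (infixl "\<odot>" 70) where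
  "A \<odot> B = (\<chi> i j. A $ i $ j * B $ i $ j)"

definition sampling_operator :: "('m \<times> 'n) set \<Rightarrow> real^'n^'m" where
  "sampling_operator \<Omega> = (\<chi> i j. if (i, j) \<in> \<Omega> then 1 else 0)"

definition real_eigenvalue :: "real^'k^'k \<Rightarrow> real \<Rightarrow> bool" where
  "real_eigenvalue A l \<longleftrightarrow> (\<exists>v. v \<noteq> 0 \<and> A *v v = l *\<^sub>R v)"

text \<open>
  Meant for symmetric matrices, whose set of real eigenvalues is finite and nonempty.
\<close>

definition lambda_min :: "real^'k^'k \<Rightarrow> real" where
  "lambda_min A = Min {l. real_eigenvalue A l}"

text \<open>
  Square integrability expresses that the common variance is finite; on a probability space it
  also makes the entries integrable. Measurability of the entries is part of \<open>indep_vars\<close>.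
\<close>

definition iid_noise :: "'w measure \<Rightarrow> ('w \<Rightarrow> real^'n^'m) \<Rightarrow> bool" where
  "iid_noise M N \<longleftrightarrow>
     prob_space M \<and>
     prob_space.indep_vars M (\<lambda>_. borel) (\<lambda>p w. N w $ fst p $ snd p) UNIV \<and>
     (\<forall>i j k l. distr M borel (\<lambda>w. N w $ i $ j) = distr M borel (\<lambda>w. N w $ k $ l)) \<and>
     (\<forall>i j. integrable M (\<lambda>w. (N w $ i $ j)\<^sup>2)) \<and>
     (\<forall>i j. prob_space.expectation M (\<lambda>w. N w $ i $ j) = 0) \<and>
     (\<exists>s. \<forall>i j. prob_space.variance M (\<lambda>w. N w $ i $ j) = s)"

end

(*
  With z = vec (X + N), the right-hand side vec Y equals (Q - R) z, so Q (vec X* - z) = - R z.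
  Since Q is symmetric and positive definite, the Rayleigh bound lambda_min(Q) |v|^2 <= v . Q v
  and Cauchy-Schwarz give lambda_min(Q) |v| <= |Q v|; apply this to v = vec X* - z and
  conclude by the triangle inequality.
*)
theory Submission
  imports Defs
begin

subsection \<open>Symmetric positive semidefinite matrices\<close>

text \<open>Symmetry is bundled in, since over the reals a nonnegative quadratic form does not force
  it.\<close>

definition psd_matrix :: "real^'k^'k \<Rightarrow> bool" where
  "psd_matrix A \<longleftrightarrow> transpose A = A \<and> (\<forall>x. 0 \<le> x \<bullet> (A *v x))"

lemma symmetric_matrix_inner:
  fixes A :: "real^'k^'k"
  assumes "transpose A = A"
  shows "x \<bullet> (A *v y) = (A *v x) \<bullet> y"
  using assms by (metis dot_lmul_matrix transpose_matrix_vector)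

lemma psd_matrix_add: "psd_matrix A \<Longrightarrow> psd_matrix B \<Longrightarrow> psd_matrix (A + B)"
  by (simp add: psd_matrix_def matrix_vector_mult_add_rdistrib inner_add_right
      transpose_def vec_eq_iff)

lemma psd_matrix_scaleR: "psd_matrix A \<Longrightarrow> 0 \<le> c \<Longrightarrow> psd_matrix (c *\<^sub>R A)"
  by (simp add: psd_matrix_def scaleR_matrix_vector_assoc [symmetric]
      transpose_def vec_eq_iff)

text \<open>A null vector minimizes the form, so the form cannot decrease from \<open>v\<close> in
  any direction. Along \<open>A *v v\<close> its slope at \<open>v\<close> is twice the squared norm
  of that vector, which must therefore vanish.\<close>

lemma psd_matrix_null_vector:
  fixes A :: "real^'k^'k"
  assumes psd: "psd_matrix A" and null: "v \<bullet> (A *v v) = 0"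
  shows "A *v v = 0"
proof -
  define w where "w = A *v v"
  define a where "a = w \<bullet> w"
  define b where "b = w \<bullet> (A *v w)"
  \<comment> \<open>For \<open>b > 0\<close> the minimizer of
    \<open>2 * t * a + t\<^sup>2 * b\<close> is \<open>- a / b\<close>. The denominator
    \<open>b + 1\<close> also covers \<open>b = 0\<close> and still makes the value negative unless
    \<open>a = 0\<close>.\<close>
  define t where "t = - a / (b + 1)"
  have b: "0 \<le> b"
    using psd by (simp add: psd_matrix_def b_def)
  have vw: "v \<bullet> (A *v w) = a"
    using psd symmetric_matrix_inner [of A v w] by (simp add: psd_matrix_def a_def w_def)
  have "0 \<le> (v + t *\<^sub>R w) \<bullet> (A *v (v + t *\<^sub>R w))"
    using psd by (simp add: psd_matrix_def)
  also have "\<dots> = 2 * t * a + t\<^sup>2 * b"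
    using null vw
    by (simp add: matrix_vector_right_distrib matrix_vector_mult_scaleR inner_add_left
        inner_add_right power2_eq_square algebra_simps b_def [symmetric] w_def [symmetric]
        a_def [symmetric])
  also have "\<dots> = - (t\<^sup>2 * (b + 2))"
  proof -
    have a: "a = - t * (b + 1)"
      using b by (simp add: t_def)
    show ?thesis
      unfolding a by (simp add: power2_eq_square algebra_simps)
  qed
  finally have "t\<^sup>2 * (b + 2) \<le> 0"
    by simp
  then have "t = 0"
    using b by (simp add: mult_le_0_iff)
  then have "a = 0"
    using b by (simp add: t_def)
  then show ?thesis
    by (simp add: a_def w_def)
qed

subsection \<open>The smallest eigenvalue\<close>

text \<open>Eigenvectors chosen for distinct eigenvalues are nonzero and pairwise orthogonal, hence
  independent, and an independent set is finite. Finiteness gives the \<open>Min\<close> in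
  \<open>lambda_min\<close> its meaning.\<close>

lemma finite_real_eigenvalues:
  fixes A :: "real^'k^'k"
  assumes sym: "transpose A = A"
  shows "finite {l. real_eigenvalue A l}"
proof -
  define f where "f l = (SOME v. v \<noteq> 0 \<and> A *v v = l *\<^sub>R v)" for l
  have f: "f l \<noteq> 0 \<and> A *v f l = l *\<^sub>R f l" if "real_eigenvalue A l" for l
    using that someI_ex [of "\<lambda>v. v \<noteq> 0 \<and> A *v v = l *\<^sub>R v"]
    unfolding real_eigenvalue_def f_def by blast
  let ?E = "{l. real_eigenvalue A l}"
  have orth: "f l \<bullet> f k = 0" if "l \<in> ?E" "k \<in> ?E" "l \<noteq> k" for l k
  proof -
    \<comment> \<open>Both sides equal \<open>f l \<bullet> (A *v f k)\<close>, by moving the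
      symmetric \<open>A\<close> across the inner product.\<close>
    have "l * (f l \<bullet> f k) = k * (f l \<bullet> f k)"
      using symmetric_matrix_inner [OF sym, of "f l" "f k"] f that by simp
    then show ?thesis
      using that by simp
  qed
  have inj: "inj_on f ?E"
  proof (rule inj_onI)
    fix l k assume "l \<in> ?E" "k \<in> ?E" "f l = f k"
    then show "l = k"
      using orth [of l k] f by auto
  qed
  have "pairwise orthogonal (f ` ?E)"
    using orth by (auto simp: pairwise_def orthogonal_def)
  moreover have "0 \<notin> f ` ?E"
    using f by auto
  ultimately have "independent (f ` ?E)"
    by (rule pairwise_orthogonal_independent)
  then show ?thesis
    using inj finite_imageD independent_imp_finite by blast
qed

text \<open>A minimizer of the quadratic form on the unit sphere is an eigenvector: the minimum \<open>l\<close>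
  makes \<open>A - l I\<close> positive semidefinite with the minimizer as a null vector.\<close>

lemma rayleigh_minimum:
  fixes A :: "real^'k^'k"
  assumes sym: "transpose A = A"
  obtains l where "real_eigenvalue A l" and "\<And>x. l * (x \<bullet> x) \<le> x \<bullet> (A *v x)"
proof -
  have "continuous_on (sphere 0 1) (\<lambda>x. x \<bullet> (A *v x))"
    by (intro continuous_intros)
  moreover have "sphere (0::real^'k) 1 \<noteq> {}"
    by simp
  ultimately have "\<exists>v\<in>sphere 0 1. \<forall>y\<in>sphere 0 1. v \<bullet> (A *v v) \<le> y \<bullet> (A *v y)"
    by (intro continuous_attains_inf compact_sphere)
  then obtain v where v: "v \<in> sphere 0 1"
    and min: "\<And>y. y \<in> sphere 0 1 \<Longrightarrow> v \<bullet> (A *v v) \<le> y \<bullet> (A *v y)"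
    by blast
  define l where "l = v \<bullet> (A *v v)"
  have bound: "l * (x \<bullet> x) \<le> x \<bullet> (A *v x)" for x
  proof (cases "x = 0")
    case False
    \<comment> \<open>Both sides of the bound are homogeneous of degree two, so minimality on the
      sphere extends to all nonzero vectors.\<close>
    let ?y = "x /\<^sub>R norm x"
    have "l \<le> ?y \<bullet> (A *v ?y)"
      unfolding l_def using False by (intro min) simp
    also have "\<dots> = (x \<bullet> (A *v x)) / (x \<bullet> x)"
      by (simp add: matrix_vector_mult_scaleR dot_square_norm power2_eq_square divide_simps)
    finally show ?thesis
      using False by (simp add: le_divide_eq)
  qed simp
  let ?B = "A - l *\<^sub>R mat 1"
  have B: "?B *v x = A *v x - l *\<^sub>R x" for x
    by (simp add: matrix_vector_mult_diff_rdistrib scaleR_matrix_vector_assoc [symmetric])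
  have "transpose ?B = ?B"
    using sym by (auto simp: transpose_def vec_eq_iff mat_def)
  then have "psd_matrix ?B"
    using bound by (simp add: psd_matrix_def B inner_diff_right)
  moreover have "v \<bullet> (?B *v v) = 0"
    using v by (simp add: B inner_diff_right l_def [symmetric] dot_square_norm)
  ultimately have "?B *v v = 0"
    by (rule psd_matrix_null_vector)
  then have "A *v v = l *\<^sub>R v"
    by (simp add: B)
  moreover have "v \<noteq> 0"
    using v by auto
  ultimately have "real_eigenvalue A l"
    unfolding real_eigenvalue_def by blast
  with bound show thesis
    by (rule that [rotated])
qed

lemma real_eigenvalue_lambda_min:
  assumes "transpose A = A"
  shows "real_eigenvalue A (lambda_min A)"
proof -
  have "{l. real_eigenvalue A l} \<noteq> {}"
    using rayleigh_minimum [OF assms] by blast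
  then show ?thesis
    using Min_in [OF finite_real_eigenvalues [OF assms]] by (simp add: lambda_min_def)
qed

text \<open>The constant from \<open>rayleigh_minimum\<close> is itself an eigenvalue, so the least
  eigenvalue lies below it.\<close>

lemma lambda_min_rayleigh:
  assumes "transpose A = A"
  shows "lambda_min A * (x \<bullet> x) \<le> x \<bullet> (A *v x)"
proof -
  obtain l where l: "real_eigenvalue A l" "\<And>x. l * (x \<bullet> x) \<le> x \<bullet> (A *v x)"
    using rayleigh_minimum [OF assms] by blast
  have "lambda_min A \<le> l"
    unfolding lambda_min_def using l(1) finite_real_eigenvalues [OF assms] by simp
  then have "lambda_min A * (x \<bullet> x) \<le> l * (x \<bullet> x)"
    by (simp add: mult_right_mono)
  with l(2) [of x] show ?thesis
    by linarith
qed

text \<open>An eigenvector for \<open>lambda_min A\<close> decides the sign: zero would put it in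
  the kernel of an invertible matrix, and a negative value would make the form negative
  there.\<close>

lemma lambda_min_pos:
  assumes psd: "psd_matrix A" and inv: "invertible A"
  shows "0 < lambda_min A"
proof -
  obtain v where v: "v \<noteq> 0" "A *v v = lambda_min A *\<^sub>R v"
    using real_eigenvalue_lambda_min psd by (auto simp: psd_matrix_def real_eigenvalue_def)
  have "A *v v \<noteq> 0"
    using inv v(1) matrix_left_invertible_ker [of A] by (auto simp: invertible_def)
  then have "lambda_min A \<noteq> 0"
    using v(2) by auto
  moreover have "0 \<le> v \<bullet> (A *v v)"
    using psd by (simp add: psd_matrix_def)
  then have "0 \<le> lambda_min A"
    using v inner_gt_zero_iff [of v] by (simp add: zero_le_mult_iff del: inner_gt_zero_iff)
  ultimately show ?thesis
    by simp
qed

lemma lambda_min_norm_le: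
  assumes "transpose A = A"
  shows "lambda_min A * norm x \<le> norm (A *v x)"
\<comment> \<open>The argument cancels one factor \<open>norm x\<close>.\<close>
proof (cases "x = 0")
  case False
  have "lambda_min A * norm x * norm x \<le> x \<bullet> (A *v x)"
    using lambda_min_rayleigh [OF assms, of x]
    by (simp add: dot_square_norm power2_eq_square mult.assoc)
  also have "\<dots> \<le> norm (A *v x) * norm x"
    using norm_cauchy_schwarz [of x "A *v x"] by (simp add: mult.commute)
  finally show ?thesis
    using False by simp
qed simp

subsection \<open>Positive semidefiniteness of the system matrix\<close>

lemma diag_matrix_mult_vec: "diag_matrix d *v x = (\<chi> i. d $ i * x $ i)"
  by (simp add: diag_matrix_def matrix_vector_mult_def vec_eq_iff if_distrib [of "\<lambda>a. a * _"]
      cong: if_cong)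

lemma psd_matrix_diag:
  assumes "\<And>i. 0 \<le> d $ i"
  shows "psd_matrix (diag_matrix d)"
proof -
  have "0 \<le> x $ i * (d $ i * x $ i)" for x i
    using mult_nonneg_nonneg [OF assms [of i] zero_le_square [of "x $ i"]]
    by (simp add: mult_ac)
  then show ?thesis
    by (auto simp: psd_matrix_def diag_matrix_mult_vec inner_vec_def intro!: sum_nonneg)
      (auto simp: diag_matrix_def transpose_def vec_eq_iff)
qed

text \<open>The factor 2 arises because the double sum meets each edge in both orientations.
  Nonnegative weights make the right-hand side visibly nonnegative.\<close>

lemma laplacian_quadratic_form:
  assumes "transpose W = W"
  shows "2 * (x \<bullet> (laplacian W *v x)) = (\<Sum>i\<in>UNIV. \<Sum>j\<in>UNIV. W $ i $ j * (x $ i - x $ j)\<^sup>2)"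
proof -
  have W: "W $ j $ i = W $ i $ j" for i j
    using assms by (metis transpose_def vec_lambda_beta)
  have "x \<bullet> (laplacian W *v x)
      = (\<Sum>i\<in>UNIV. \<Sum>j\<in>UNIV. W $ i $ j * (x $ i)\<^sup>2) - (\<Sum>i\<in>UNIV. \<Sum>j\<in>UNIV. W $ i $ j * x $ i * x $ j)"
    unfolding laplacian_def degree_matrix_def matrix_vector_mult_diff_rdistrib diag_matrix_mult_vec
    by (simp add: inner_vec_def matrix_vector_mult_def sum_subtractf
        sum_distrib_left sum_distrib_right power2_eq_square algebra_simps)
  \<comment> \<open>Row sums and column sums of a symmetric \<open>W\<close> agree, so the two
    squares contribute equally.\<close>
  moreover have "(\<Sum>i\<in>UNIV. \<Sum>j\<in>UNIV. W $ i $ j * (x $ i)\<^sup>2) = (\<Sum>i\<in>UNIV. \<Sum>j\<in>UNIV. W $ i $ j * (x $ j)\<^sup>2)"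
    by (subst sum.swap) (simp add: W)
  moreover have "(\<Sum>i\<in>UNIV. \<Sum>j\<in>UNIV. W $ i $ j * (x $ i - x $ j)\<^sup>2)
      = (\<Sum>i\<in>UNIV. \<Sum>j\<in>UNIV. W $ i $ j * (x $ i)\<^sup>2) + (\<Sum>i\<in>UNIV. \<Sum>j\<in>UNIV. W $ i $ j * (x $ j)\<^sup>2)
        - 2 * (\<Sum>i\<in>UNIV. \<Sum>j\<in>UNIV. W $ i $ j * x $ i * x $ j)"
    unfolding sum_distrib_left sum.distrib [symmetric] sum_subtractf [symmetric]
    by (intro sum.cong refl) (simp add: power2_eq_square algebra_simps)
  ultimately show ?thesis
    by linarith
qed

lemma psd_matrix_laplacian:
  assumes "weight_matrix W"
  shows "psd_matrix (laplacian W)"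
proof -
  have W: "transpose W = W" "\<And>i j. 0 \<le> W $ i $ j"
    using assms by (auto simp: weight_matrix_def)
  have "transpose (laplacian W) = laplacian W"
    using W(1) by (auto simp: laplacian_def degree_matrix_def diag_matrix_def transpose_def vec_eq_iff)
  moreover have "0 \<le> 2 * (x \<bullet> (laplacian W *v x))" for x
    unfolding laplacian_quadratic_form [OF W(1)] by (intro sum_nonneg mult_nonneg_nonneg W(2)) simp
  ultimately show ?thesis
    by (simp add: psd_matrix_def)
qed

section \<open>Kronecker products with an identity matrix\<close>

lemma sum_UNIV_prod:
  "(\<Sum>p\<in>UNIV. f p) = (\<Sum>a\<in>UNIV. \<Sum>b\<in>UNIV. f (a, b))"
  by (simp add: sum.cartesian_product)

text \<open>This product is block diagonal: it applies \<open>B\<close> to each column of the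
  underlying matrix, so its form is a sum of forms of \<open>B\<close> over the columns.\<close>

lemma psd_matrix_kronecker_left_id:
  assumes "psd_matrix B"
  shows "psd_matrix (mat 1 \<otimes>\<^sub>K B :: real^('n::finite \<times> 'm::finite)^('n \<times> 'm))"
proof -
  let ?K = "mat 1 \<otimes>\<^sub>K B :: real^('n \<times> 'm)^('n \<times> 'm)"
  have entry: "(?K *v x) $ (j, i) = (B *v (\<chi> k. x $ (j, k))) $ i" for x j i
    unfolding kronecker_def mat_def matrix_vector_mult_def sum_UNIV_prod
    \<comment> \<open>After the swap the inner sum runs over the column index and collapses by the
      entries of the identity.\<close>
    by (subst sum.swap) (simp add: if_distrib [of "\<lambda>a. a * _"] cong: if_cong)
  have "x \<bullet> (?K *v x) = (\<Sum>j\<in>UNIV. (\<chi> k. x $ (j, k)) \<bullet> (B *v (\<chi> k. x $ (j, k))))" for x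
    by (simp add: inner_vec_def sum_UNIV_prod entry)
  moreover have "transpose ?K = ?K"
    using assms by (auto simp: psd_matrix_def kronecker_def transpose_def mat_def vec_eq_iff)
  ultimately show ?thesis
    using assms by (simp add: psd_matrix_def sum_nonneg)
qed

text \<open>Here \<open>B\<close> acts on each row of the underlying matrix, and the form splits
  over the rows.\<close>

lemma psd_matrix_kronecker_right_id:
  assumes "psd_matrix B"
  shows "psd_matrix (B \<otimes>\<^sub>K mat 1 :: real^('n::finite \<times> 'm::finite)^('n \<times> 'm))"
proof -
  let ?K = "B \<otimes>\<^sub>K mat 1 :: real^('n \<times> 'm)^('n \<times> 'm)"
  have entry: "(?K *v x) $ (j, i) = (B *v (\<chi> k. x $ (k, i))) $ j" for x j i
    unfolding kronecker_def mat_def matrix_vector_mult_def sum_UNIV_prod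
    by (simp add: if_distrib [of "\<lambda>a. a * _"] if_distrib [of "\<lambda>a. _ * a"] cong: if_cong)
  have "x \<bullet> (?K *v x) = (\<Sum>i\<in>UNIV. (\<chi> k. x $ (k, i)) \<bullet> (B *v (\<chi> k. x $ (k, i))))" for x
    \<comment> \<open>The inner product expands with columns outermost, whereas the claim groups by
      rows.\<close>
    by (simp add: inner_vec_def sum_UNIV_prod entry) (rule sum.swap)
  moreover have "transpose ?K = ?K"
    using assms by (auto simp: psd_matrix_def kronecker_def transpose_def mat_def vec_eq_iff)
  ultimately show ?thesis
    using assms by (simp add: psd_matrix_def sum_nonneg)
qed

section \<open>The reconstruction error bound\<close>

lemma vectorize_add: "vectorize (X + Z) = vectorize X + vectorize Z"
  by (simp add: vectorize_def vec_eq_iff)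

text \<open>This turns entrywise sampling into the diagonal summand of \<open>Q\<close>.\<close>

lemma vectorize_hadamard: "vectorize (A \<odot> Z) = diag_matrix (vectorize A) *v vectorize Z"
  by (simp add: diag_matrix_mult_vec vectorize_def hadamard_def vec_eq_iff)

theorem lemma1:
  fixes Wr Lr :: "real^'m^'m" and Wc Lc :: "real^'n^'n"
    and \<alpha> \<beta> :: real
    and \<Omega> :: "('m \<times> 'n) set"
    and R Q :: "real^('n \<times> 'm)^('n \<times> 'm)"
    and X :: "real^'n^'m"
    and M :: "'w measure"
    and N Y Xstar :: "'w \<Rightarrow> real^'n^'m"
    and \<rho> :: "'w \<Rightarrow> real"
  assumes "weight_matrix Wr" and "weight_matrix Wc"
    and "Lr = laplacian Wr" and "Lc = laplacian Wc"
    and "\<alpha> > 0" and "\<beta> > 0"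
    and "R = \<alpha> *\<^sub>R (mat 1 \<otimes>\<^sub>K Lr) + \<beta> *\<^sub>R (Lc \<otimes>\<^sub>K mat 1)"
    and "Q = diag_matrix (vectorize (sampling_operator \<Omega>)) + R"
    and "invertible Q"
    and "iid_noise M N"
    and "\<And>w. w \<in> space M \<Longrightarrow> Y w = sampling_operator \<Omega> \<odot> (X + N w)"
    and "\<And>w. w \<in> space M \<Longrightarrow> Q *v vectorize (Xstar w) = vectorize (Y w)"
    and "\<And>w. w \<in> space M \<Longrightarrow> \<rho> w = norm (R *v vectorize (X + N w))"
  shows "\<forall>w \<in> space M.
    norm (vectorize (Xstar w) - vectorize X) \<le> \<rho> w / lambda_min Q + norm (vectorize (N w))"
proof
  fix w assume w: "w \<in> space M"
  define z where "z = vectorize (X + N w)"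
  define e where "e = vectorize (Xstar w) - z"
  have "psd_matrix R"
    unfolding assms(7) assms(3) assms(4) using assms(1,2,5,6)
    by (intro psd_matrix_add psd_matrix_scaleR psd_matrix_kronecker_left_id
        psd_matrix_kronecker_right_id psd_matrix_laplacian) auto
  then have psd: "psd_matrix Q"
    unfolding assms(8)
    by (intro psd_matrix_add psd_matrix_diag) (auto simp: vectorize_def sampling_operator_def)
  \<comment> \<open>Semidefiniteness and invertibility combine here, which justifies the later
    division by \<open>lambda_min Q\<close>.\<close>
  have pos: "0 < lambda_min Q"
    using psd assms(9) by (rule lambda_min_pos)
  have "Q *v vectorize (Xstar w) = diag_matrix (vectorize (sampling_operator \<Omega>)) *v z"
    using w by (simp add: assms(11,12) vectorize_hadamard z_def)
  moreover have "Q *v z = diag_matrix (vectorize (sampling_operator \<Omega>)) *v z + R *v z"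
    by (simp add: assms(8) matrix_vector_mult_add_rdistrib)
  \<comment> \<open>The sampling terms cancel because the error is measured from the noisy signal
    \<open>z\<close>, not from \<open>X\<close>.\<close>
  ultimately have "Q *v e = - (R *v z)"
    by (simp add: e_def matrix_vector_mult_diff_distrib)
  then have "norm (Q *v e) = \<rho> w"
    using w by (simp add: assms(13) z_def)
  then have "lambda_min Q * norm e \<le> \<rho> w"
    using lambda_min_norm_le [of Q e] psd by (simp add: psd_matrix_def)
  then have "norm e \<le> \<rho> w / lambda_min Q"
    using pos by (simp add: pos_le_divide_eq mult.commute)
  moreover have "vectorize (Xstar w) - vectorize X = e + vectorize (N w)"
    by (simp add: e_def z_def vectorize_add)
  ultimately show "norm (vectorize (Xstar w) - vectorize X)
      \<le> \<rho> w / lambda_min Q + norm (vectorize (N w))"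
    by (simp add: norm_triangle_le)
qed

end
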